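(* Let $\mathcal{A}$ be a unital $C^*$-algebra and $\mathcal{B}$ be a unital $C^*$-subalgebra of $\mathcal{A}$ (with common unit). Then $$d_{KK}\big(\mathcal{B},u\mathcal{B}u^*\big)\leq 2\,d\big(u,\mathcal{N}_{\mathcal{A}}(\mathcal{B})\big)\leq 2\|u-\mathbf{1}\|$$ for all $u\in\mathcal{U}(\mathcal{A})$.
   Context: $\mathcal{U}(\mathcal{A})$ is the unitary group of $\mathcal{A}$; $\mathcal{N}_{\mathcal{A}}(\mathcal{B})=\{u\in\mathcal{U}(\mathcal{A}):u\mathcal{B}u^*=\mathcal{B}\}$. For a subset $K$ of a normed space, $d(x,K)=\inf\{\|x-y\|:y\in K\}$, and $B_1(X)$ is the closed unit ball of $X$. The Kadison-Kastler distance between subalgebras $\mathcal{C},\mathcal{D}$ of a normed algebra is $d_{KK}(\mathcal{C},\mathcal{D})=\max\{\sup_{x\in B_1(\mathcal{C})}d(x,B_1(\mathcal{D})),\ \sup_{z\in B_1(\mathcal{D})}d(z,B_1(\mathcal{C}))\}$. *)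

theory Defs
  imports "HOL-Analysis.Analysis"
begin

text \<open>The type class axioms do not require \<open>0 \<noteq> 1\<close>, so the zero algebra is a model;
  \<open>norm 1 = 1\<close> in all other models follows from the C*-identity.\<close>

class unital_complex_banach_algebra = banach + real_normed_algebra + monoid_mult +
  fixes scaleC :: "complex \<Rightarrow> 'a \<Rightarrow> 'a"  (infixr \<open>*\<^sub>C\<close> 75)
  assumes scaleC_add_right: "c *\<^sub>C (x + y) = c *\<^sub>C x + c *\<^sub>C y"
    and scaleC_add_left: "(c + d) *\<^sub>C x = c *\<^sub>C x + d *\<^sub>C x"
    and scaleC_scaleC: "c *\<^sub>C d *\<^sub>C x = (c * d) *\<^sub>C x"
    and scaleR_eq_scaleC: "r *\<^sub>R x = complex_of_real r *\<^sub>C x"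
    and mult_scaleC_left: "(c *\<^sub>C x) * y = c *\<^sub>C (x * y)"
    and mult_scaleC_right: "x * (c *\<^sub>C y) = c *\<^sub>C (x * y)"
    and norm_scaleC: "norm (c *\<^sub>C x) = cmod c * norm x"

class unital_cstar_algebra = unital_complex_banach_algebra +
  fixes star :: "'a \<Rightarrow> 'a"
  assumes star_star: "star (star x) = x"
    and star_add: "star (x + y) = star x + star y"
    and star_scaleC: "star (c *\<^sub>C x) = cnj c *\<^sub>C star x"
    and star_mult: "star (x * y) = star y * star x"
    and cstar_identity: "norm (star x * x) = (norm x)\<^sup>2"

definition unital_cstar_subalgebra :: "'a::unital_cstar_algebra set \<Rightarrow> bool" where
  "unital_cstar_subalgebra B \<longleftrightarrow>
     1 \<in> B \<and>
     (\<forall>x\<in>B. \<forall>y\<in>B. x + y \<in> B) \<and>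
     (\<forall>c. \<forall>x\<in>B. c *\<^sub>C x \<in> B) \<and>
     (\<forall>x\<in>B. \<forall>y\<in>B. x * y \<in> B) \<and>
     (\<forall>x\<in>B. star x \<in> B) \<and>
     closed B"

definition unitary_group :: "'a::unital_cstar_algebra set" where
  "unitary_group = {u. star u * u = 1 \<and> u * star u = 1}"

definition conj_image :: "'a::unital_cstar_algebra \<Rightarrow> 'a set \<Rightarrow> 'a set" where
  "conj_image u B = (\<lambda>b. u * b * star u) ` B"

definition unitary_normalizer :: "'a::unital_cstar_algebra set \<Rightarrow> 'a set" where
  "unitary_normalizer B = {u \<in> unitary_group. conj_image u B = B}"

definition unit_ball :: "'a::real_normed_vector set \<Rightarrow> 'a set" where
  "unit_ball X = {x \<in> X. norm x \<le> 1}"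

text \<open>If \<open>0\<close> lies in both \<open>C\<close> and \<open>D\<close>, the unit balls are nonempty and the distances are
  bounded by \<open>1\<close>, so that \<^const>\<open>infdist\<close> and the real suprema are genuine.\<close>

definition KK_dist :: "'a::real_normed_vector set \<Rightarrow> 'a set \<Rightarrow> real" where
  "KK_dist C D =
     max (SUP x\<in>unit_ball C. infdist x (unit_ball D))
         (SUP z\<in>unit_ball D. infdist z (unit_ball C))"

end

theory Submission
  imports Defs
begin

text \<open>If \<open>v\<close> normalizes \<open>B\<close>, every point of the unit ball of \<open>B\<close> has the form \<open>v b v\<^sup>*\<close> and every
  point of the unit ball of \<open>u B u\<^sup>*\<close> the form \<open>u b u\<^sup>*\<close>, with \<open>b\<close> in the unit ball of \<open>B\<close>.
  Matching the points with the same \<open>b\<close> moves each of them by at most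
  \<open>\<parallel>(v - u) b v\<^sup>* + u b (v - u)\<^sup>*\<parallel> \<le> 2 \<parallel>u - v\<parallel>\<close>. Take the infimum over \<open>v\<close> for the first
  inequality, and \<open>v = 1\<close> for the second.\<close>

lemma star_one: "star (1::'a::unital_cstar_algebra) = 1"
  by (metis mult_1_left mult_1_right star_mult star_star)

lemma star_diff: "star (x - y) = star x - star (y::'a::unital_cstar_algebra)"
  by (metis add_diff_cancel diff_add_cancel star_add)

text \<open>Cancelling \<open>norm y\<close> from the C*-identity combined with submultiplicativity
  gives one inequality; at \<open>star x\<close> it becomes the reverse one.\<close>

lemma norm_star: "norm (star x) = norm (x::'a::unital_cstar_algebra)"
proof -
  have le: "norm y \<le> norm (star y)" for y :: 'a
  proof (cases "norm y = 0")
    case False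
    have "norm y * norm y \<le> norm (star y) * norm y"
      using norm_mult_ineq[of "star y" y] by (simp add: cstar_identity power2_eq_square)
    with False show ?thesis by simp
  qed simp
  show ?thesis using le[of x] le[of "star x"] by (simp add: star_star)
qed

text \<open>By the C*-identity \<open>norm 1\<close> equals its own square. An upper bound rather
  than an equation, because the norm is 0 in the zero algebra.\<close>

lemma norm_one_le: "norm (1::'a::unital_cstar_algebra) \<le> 1"
proof -
  have "(norm (1::'a))\<^sup>2 = norm (1::'a)"
    using cstar_identity[of "1::'a"] by (simp add: star_one)
  then have "norm (1::'a) = 0 \<or> norm (1::'a) = 1"
    unfolding power2_eq_square by (metis mult_cancel_left2)
  then show ?thesis by linarith
qed

lemma norm_unitary_le:
  fixes u :: "'a::unital_cstar_algebra"
  assumes "u \<in> unitary_group"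
  shows "norm u \<le> 1"
proof -
  have "(norm u)\<^sup>2 \<le> 1"
    using cstar_identity[of u] assms norm_one_le[where 'a='a] by (simp add: unitary_group_def)
  then show ?thesis by (metis one_power2 power2_le_imp_le zero_le_one)
qed

lemma star_unitary: "u \<in> unitary_group \<Longrightarrow> star u \<in> unitary_group"
  by (simp add: unitary_group_def star_star)

lemma norm_mult3_le:
  fixes x y z :: "'a::real_normed_algebra"
  shows "norm (x * y * z) \<le> norm x * norm y * norm z"
  by (meson mult_right_mono norm_ge_zero norm_mult_ineq order_trans)

text \<open>Conjugation by \<open>u\<close> is contractive, and so is its inverse, conjugation by
  \<open>star u\<close>; hence both are isometric.\<close>

lemma norm_conj_unitary:
  fixes b :: "'a::unital_cstar_algebra"
  assumes u: "u \<in> unitary_group"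
  shows "norm (u * b * star u) = norm b"
proof -
  have le: "norm (v * c * star v) \<le> norm c" if "v \<in> unitary_group" for v c :: 'a
  proof -
    have "norm (v * c * star v) \<le> norm v * norm c * norm v"
      using norm_mult3_le[of v c "star v"] by (simp add: norm_star)
    also have "\<dots> \<le> 1 * norm c * 1"
      by (intro mult_mono norm_unitary_le that) auto
    finally show ?thesis by simp
  qed
  have "star u * (u * b * star u) * star (star u) = (star u * u) * b * (star u * u)"
    by (simp add: star_star mult.assoc)
  also have "\<dots> = b" using u by (simp add: unitary_group_def)
  finally show ?thesis
    using le[OF u, of b] le[OF star_unitary[OF u], of "u * b * star u"] by simp
qed

lemma dist_conj_unitary_le:
  fixes b u v :: "'a::unital_cstar_algebra"
  assumes u: "u \<in> unitary_group" and v: "v \<in> unitary_group" and b: "norm b \<le> 1"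
  shows "dist (u * b * star u) (v * b * star v) \<le> 2 * dist u v"
proof -
  \<comment> \<open>Add and subtract \<open>v * b * star u\<close>.\<close>
  have "u * b * star u - v * b * star v = (u - v) * b * star u + v * b * star (u - v)"
    by (simp add: star_diff algebra_simps)
  then have "dist (u * b * star u) (v * b * star v)
      \<le> norm ((u - v) * b * star u) + norm (v * b * star (u - v))"
    by (simp add: dist_norm norm_triangle_ineq)
  also have "\<dots> \<le> norm (u - v) * norm b * norm u + norm v * norm b * norm (u - v)"
    using norm_mult3_le[of "u - v" b "star u"] norm_mult3_le[of v b "star (u - v)"]
    by (simp add: norm_star)
  also have "\<dots> \<le> norm (u - v) * 1 * 1 + 1 * 1 * norm (u - v)"
    by (intro add_mono mult_mono norm_unitary_le u v b) auto
  finally show ?thesis by (simp add: dist_norm)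
qed

text \<open>Since conjugation is isometric, the unit balls of all conjugates are images of one set,
  so their points can be matched.\<close>

lemma unit_ball_conj_image:
  assumes "u \<in> unitary_group"
  shows "unit_ball (conj_image u B) = conj_image u (unit_ball B)"
  using assms by (auto simp: unit_ball_def conj_image_def norm_conj_unitary)

text \<open>Exchanging \<open>u\<close> and \<open>v\<close> turns the bound for one supremum in
  \<open>KK_dist\<close> into that for the other.\<close>

lemma SUP_infdist_conj_image_le:
  assumes u: "u \<in> unitary_group" and v: "v \<in> unitary_group" and "K \<noteq> {}"
    and K: "\<And>b. b \<in> K \<Longrightarrow> norm b \<le> 1"
  shows "(SUP x\<in>conj_image u K. infdist x (conj_image v K)) \<le> 2 * dist u v"
proof (rule cSUP_least)
  show "conj_image u K \<noteq> {}" using \<open>K \<noteq> {}\<close> by (simp add: conj_image_def)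
next
  fix x assume "x \<in> conj_image u K"
  then obtain b where b: "b \<in> K" "x = u * b * star u" by (auto simp: conj_image_def)
  have "infdist x (conj_image v K) \<le> dist x (v * b * star v)"
    using b(1) by (intro infdist_le) (auto simp: conj_image_def)
  also have "\<dots> \<le> 2 * dist u v"
    using b dist_conj_unitary_le[OF u v K] by simp
  finally show "infdist x (conj_image v K) \<le> 2 * dist u v" .
qed

text \<open>Applied with \<open>v\<close> in the normalizer, where the first conjugate is
  \<open>B\<close> itself.\<close>

lemma KK_dist_conj_image_le:
  assumes u: "u \<in> unitary_group" and v: "v \<in> unitary_group" and "0 \<in> B"
  shows "KK_dist (conj_image v B) (conj_image u B) \<le> 2 * dist u v"
proof -
  have ne: "unit_ball B \<noteq> {}" using \<open>0 \<in> B\<close> by (auto simp: unit_ball_def)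
  have le: "norm b \<le> 1" if "b \<in> unit_ball B" for b using that by (simp add: unit_ball_def)
  show ?thesis
    using SUP_infdist_conj_image_le[OF u v ne le] SUP_infdist_conj_image_le[OF v u ne le]
    by (simp add: KK_dist_def unit_ball_conj_image u v dist_commute)
qed

lemma one_in_unitary_normalizer: "1 \<in> unitary_normalizer B"
  by (simp add: unitary_normalizer_def unitary_group_def conj_image_def star_one)

text \<open>Zero witnesses that the unit ball of \<open>B\<close> is nonempty, as the suprema
  require.\<close>

lemma zero_in_unital_cstar_subalgebra:
  assumes "unital_cstar_subalgebra B"
  shows "0 \<in> B"
proof -
  have "0 *\<^sub>C 1 \<in> B" using assms by (simp add: unital_cstar_subalgebra_def)
  then show ?thesis using scaleR_eq_scaleC[of 0 "1::'a"] by simp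
qed

theorem lemma3p5:
  fixes B :: "'a::unital_cstar_algebra set" and u :: 'a
  assumes "unital_cstar_subalgebra B"
    and "u \<in> unitary_group"
  shows "KK_dist B (conj_image u B) \<le> 2 * infdist u (unitary_normalizer B)
       \<and> 2 * infdist u (unitary_normalizer B) \<le> 2 * norm (u - 1)"
proof
  have ne: "unitary_normalizer B \<noteq> {}" using one_in_unitary_normalizer by blast
  \<comment> \<open>Halving makes the left side a lower bound of \<open>dist u v\<close> over the
    normalizer. As that set is nonempty, \<open>infdist\<close> is a true infimum and not the
    default 0.\<close>
  have "KK_dist B (conj_image u B) / 2 \<le> infdist u (unitary_normalizer B)"
    unfolding infdist_notempty[OF ne]
  proof (rule cINF_greatest[OF ne])
    fix v assume "v \<in> unitary_normalizer B"
    then have "v \<in> unitary_group" "conj_image v B = B" by (auto simp: unitary_normalizer_def)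
    with KK_dist_conj_image_le[OF assms(2) this(1) zero_in_unital_cstar_subalgebra[OF assms(1)]]
    show "KK_dist B (conj_image u B) / 2 \<le> dist u v" by simp
  qed
  then show "KK_dist B (conj_image u B) \<le> 2 * infdist u (unitary_normalizer B)" by simp
next
  show "2 * infdist u (unitary_normalizer B) \<le> 2 * norm (u - 1)"
    using infdist_le[OF one_in_unitary_normalizer, of u B] by (simp add: dist_norm)
qed

end
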